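(* Let $T$ be an uncertainty polynomial functor, $D$ a Lindenbaum $T$-deduction system, $\Delta_{Pl}S\in\mathsf{Ing}\,T$ and $x\in X_{\Delta_{Pl}S}$. For $\varphi::S$ put $\gamma_x(|\varphi|_S)=\sup\{q\in[0,1]:\mathsf{Pl}_{\ge q}\varphi\in x\}$. Then $\gamma_x$ is a well-defined (depending only on $|\varphi|_S$) plausibility measure on $(X_S,\Sigma_S)$.
   Context: Uncertainty spaces. An uncertainty space is $(X,\Sigma)$ with $\Sigma$ an algebra of subsets of $X$ (nonempty, closed under finite unions and complements $U^c=X\setminus U$). A (finitely additive) probability measure is $\mu:\Sigma\to[0,1]$ with $\mu(\emptyset)=0$, $\mu(X)=1$, $\mu(U\cup V)=\mu(U)+\mu(V)$ for disjoint $U,V$. An upper probability measure is $g(U)=\sup_{\mu\in\mathcal P}\mu(U)$ for a nonempty set $\mathcal P$ of probability measures. A plausibility measure is $\gamma:\Sigma\to[0,1]$ with $\gamma(\emptyset)=0$, $\gamma(X)=1$, $\gamma(U_1\cap\dots\cap U_n)\le\sum_{\emptyset\ne I\subseteq J_n}(-1)^{|I|+1}\gamma(\bigcup_{i\in I}U_i)$ for all $n\ge1$ and $U_1,\dots,U_n\in\Sigma$ ($J_n=\{1,\dots,n\}$). A possibility measure is $\pi:\Sigma\to[0,1]$ with $\pi(\emptyset)=0$, $\pi(X)=1$, $\pi(U\cup V)=\max\{\pi(U),\pi(V)\}$. $\Delta^*X,\Delta X,\Delta_{Pl}X,\Delta_{Ps}X$ are the sets of these four kinds of measures, with algebras generated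 by $\beta^{p,q}(U)=\{g:g(U)\ge p,1-g(U^c)\ge q\}$, $\beta^p_{pr}(U)=\{\mu:\mu(U)\ge p\}$, $\beta^{p,q}_{Pl}(U)$, $\beta^{p,q}_{Ps}(U)$ (defined like $\beta^{p,q}$). Products, coproducts and constant functors (with space $(M,\Sigma_M)$) as usual. Uncertainty polynomial functors: smallest class of endofunctors containing $Id$ and constants, closed under pointwise $\times$, $+$ and composition with $\Delta^*,\Delta,\Delta_{Pl},\Delta_{Ps}$. Language. $\mathsf{Ing}\,T$: $\mathsf{Ing}\,Id=\{Id\}$, $\mathsf{Ing}\,M=\{M,Id\}$, $\mathsf{Ing}(T_1\times T_2)=\{T_1\times T_2\}\cup\mathsf{Ing}\,T_1\cup\mathsf{Ing}\,T_2$, same for $+$, $\mathsf{Ing}\,US=\{US\}\cup\mathsf{Ing}\,S$ for $U\in\{\Delta^*,\Delta,\Delta_{Pl},\Delta_{Ps}\}$. Formulas of sort $S$ ($\mathsf{Form}_S$): $\bot_S$; $\varphi\to\psi$; $A:M$ for $A\in\Sigma_M$ or $A=\{m\}$; $[\mathsf{pr}_j]\varphi:S_1\times S_2$ ($\varphi:S_j$); $[\mathsf{in}_j]\varphi:S_1+S_2$ ($\varphi:S_j$); $[\mathsf{next}]\varphi:Id$ ($\varphi:T$); for $\varphi::S$ (all constant subformulas in $\Sigma_M$) and $p,q\in[0,1]$: $[(p,q)]\varphi:\Delta^*S$, $\mathsf P_{\ge p}\varphi:\Delta S$, $[(p,q)]_{Pl}\varphi:\Delta_{Pl}S$, $[(p,q)]_{Ps}\varphi:\Delta_{Ps}S$.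 Non-probabilistic labels $\kappa\in\{\mathsf{pr}_j,\mathsf{in}_j,\mathsf{next}\}$. Abbreviations: $\neg,\vee,\wedge,\leftrightarrow,\top_S$; $\mathsf U_{\ge p}=[(p,0)]$, $\mathsf L_{\ge p}=[(0,p)]$, $\mathsf U_{\le p}\varphi=[(0,1-p)]\neg\varphi$, $\mathsf U_{<p}=\neg\mathsf U_{\ge p}$; $\mathsf P_{<p}\varphi=\neg\mathsf P_{\ge p}\varphi$, $\mathsf P_{\le p}\varphi=\mathsf P_{\ge1-p}\neg\varphi$; $\mathsf{Pl}_{\ge p}=[(p,0)]_{Pl}$, $\mathsf{Bel}_{\ge p}=[(0,p)]_{Pl}$, $\mathsf{Pl}_{\le p}\varphi=[(0,1-p)]_{Pl}\neg\varphi$, $\mathsf{Bel}_{\le p}\varphi=[(1-p,0)]_{Pl}\neg\varphi$, $\mathsf{Pl}_{<p}=\neg\mathsf{Pl}_{\ge p}$, $\mathsf{Bel}_{<p}=\neg\mathsf{Bel}_{\ge p}$; $\mathsf{Ps},\mathsf N$ analogously with $[(\cdot,\cdot)]_{Ps}$. $\mathsf{Pl}_{[i]p}$ is $\mathsf{Pl}_{\le p}$ for odd $i$, $\mathsf{Pl}_{\ge p}$ for even $i$; $\psi_I=\bigvee_{i\in I}\varphi_i$. Axioms $Ax_S$ ($\varphi,\psi::S'$ in measure cases): Boolean tautologies; $\{c\}\to A$ ($c\in A$), $\{c\}\to\neg A$ ($c\notin A$); $\neg[\kappa]\varphi\to[\kappa]\neg\varphi$; $\neg[\mathsf{pr}_j]\bot$;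 $\neg[\mathsf{in}_1]\bot_{S_1}\leftrightarrow[\mathsf{in}_2]\bot_{S_2}$; $\neg[\mathsf{next}]\bot_T$. $\Delta^*S'$: $\mathsf U_{\le p}\varphi\to\mathsf U_{<q}\varphi$ ($p<q$); $\mathsf U_{<p}\varphi\to\mathsf U_{\le p}\varphi$; $\mathsf L_{\ge1}(\varphi\to\psi)\to(\mathsf U_{\ge p}\varphi\to\mathsf U_{\ge p}\psi)$; $[(p,q)]\varphi\leftrightarrow(\mathsf U_{\ge p}\varphi\wedge\mathsf L_{\ge q}\varphi)$. $\Delta S'$: $\mathsf P_{\le p}\varphi\to\mathsf P_{<q}\varphi$ ($p<q$); $\mathsf P_{<p}\varphi\to\mathsf P_{\le p}\varphi$; $\mathsf P_{\ge1}(\varphi\to\psi)\to(\mathsf P_{\ge p}\varphi\to\mathsf P_{\ge p}\psi)$. $\Delta_{Pl}S'$: $\mathsf{Pl}_{\le p}\varphi\to\mathsf{Pl}_{<q}\varphi$ ($p<q$); $\mathsf{Pl}_{<p}\varphi\to\mathsf{Pl}_{\le p}\varphi$; $\mathsf{Pl}_{\le p}\varphi\to\mathsf{Bel}_{\le p}\varphi$; $\mathsf{Bel}_{\ge1}(\varphi\to\psi)\to(\mathsf{Pl}_{\ge p}\varphi\to\mathsf{Pl}_{\ge p}\psi)$; $[(p,q)]_{Pl}\varphi\leftrightarrow(\mathsf{Pl}_{\ge p}\varphi\wedge\mathsf{Bel}_{\ge q}\varphi)$; for $\varphi_1,\dots,\varphi_n::S'$, $p_I\in[0,1]$ ($\emptyset\ne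 I\subseteq J_n$), $q=\sum_I(-1)^{|I|+1}p_I$: if $q\ge0$, $p=\min(q,1)$: $(\bigwedge_I\mathsf{Pl}_{[|I|]p_I}\psi_I)\to\mathsf{Pl}_{\le p}(\bigwedge_i\varphi_i)$; if $q<0$: $\neg\bigwedge_I\mathsf{Pl}_{[|I|]p_I}\psi_I$. $\Delta_{Ps}S'$: $\mathsf{Ps}_{\le p}\varphi\to\mathsf{Ps}_{<q}\varphi$ ($p<q$); $\mathsf{Ps}_{<p}\varphi\to\mathsf{Ps}_{\le p}\varphi$; $\mathsf{Ps}_{\le0}\bot_{S'}$; $\mathsf{Ps}_{\le p}\varphi\to\mathsf N_{\le p}\varphi$; $(\mathsf{Ps}_{\le p}\varphi\wedge\mathsf{Ps}_{\le q}\psi)\to\mathsf{Ps}_{\le\max(p,q)}(\varphi\vee\psi)$; $\mathsf N_{\ge1}(\varphi\to\psi)\to(\mathsf{Ps}_{\ge p}\varphi\to\mathsf{Ps}_{\ge p}\psi)$; $[(p,q)]_{Ps}\varphi\leftrightarrow(\mathsf{Ps}_{\ge p}\varphi\wedge\mathsf N_{\ge q}\varphi)$. A $T$-deduction system is a family $\vdash_S\subseteq\mathcal P(\mathsf{Form}_S)\times\mathsf{Form}_S$ ($\vdash_S\varphi$ means $\emptyset\vdash_S\varphi$) satisfying: Assumption ($\varphi\in\Gamma\cup Ax_S\Rightarrow\Gamma\vdash_S\varphi$); Modus ponens $\{\varphi,\varphi\to\psi\}\vdash_S\psi$; Cut (if $\Gamma\vdash_S\psi$ for all $\psi\in\Lambda$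 and $\Lambda\vdash_S\varphi$ then $\Gamma\vdash_S\varphi$); Deduction; Constant ($\{\neg\{c\}:c\in M\}\vdash_M\bot_M$); Definite box ($\Gamma\vdash_{S'}\psi\Rightarrow[\kappa]\Gamma\vdash_S[\kappa]\psi$); Necessitation (for $\varphi::S$, $\vdash_S\varphi$ implies $\vdash_{\Delta^*S}\mathsf L_{\ge1}\varphi$, $\vdash_{\Delta S}\mathsf P_{\ge1}\varphi$, $\vdash_{\Delta_{Pl}S}\mathsf{Bel}_{\ge1}\varphi$, $\vdash_{\Delta_{Ps}S}\mathsf N_{\ge1}\varphi$ when these sorts are ingredients); Archimedean ($\{\mathsf O_{\ge q}\psi:q<p\}\vdash\mathsf O_{\ge p}\psi$ for $\mathsf O\in\{\mathsf U,\mathsf L,\mathsf P,\mathsf{Pl},\mathsf{Bel},\mathsf{Ps},\mathsf N\}$); Cover rules for $\mathsf O\in\{\mathsf U,\mathsf P\}$ at sorts $\Delta^*S$, resp. $\Delta S$, with $\varphi,\varphi_i::S$, $k\ge0$: (C1) if $n\ge1$, $\vdash_S\varphi\to\bigvee_{I\subseteq J_m,|I|=n+k}\bigwedge_{i\in I}\varphi_i$, $\vdash_S\bigvee_{I\subseteq J_m,|I|=k}\bigwedge_{i\in I}\varphi_i$, $p_i\in[0,1]$, $p=\max(0,\min(1,(\sum p_i-k)/n))$, then $\vdash(\bigwedge_i\mathsf O_{\le p_i}\varphi_i)\to\mathsf O_{\le p}\varphi$; (C2) if $\vdash_S\bigvee_{I\subseteq J_m,|I|=k}\bigwedge_{i\in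 I}\varphi_i$ and $\sum p_i<k$, then $\vdash\neg\bigwedge_i\mathsf O_{\le p_i}\varphi_i$. $\Gamma$ is $\vdash_S$-consistent if $\Gamma\not\vdash_S\bot_S$; $\vdash_S$-maximal if consistent and negation complete ($\varphi\in\Gamma$ iff $\neg\varphi\notin\Gamma$). $D$ is Lindenbaum if every consistent set extends to a maximal one. $X_S$ = set of $\vdash_S$-maximal sets, $|\varphi|_S=\{y\in X_S:\varphi\in y\}$, $\Sigma_S=\{|\varphi|_S:\varphi::S\}$. *)

theory Defs
  imports "HOL-Analysis.Sigma_Algebra"
begin

section \<open>Plausibility measures\<close>

definition plausibility_measure :: "'x set \<Rightarrow> 'x set set \<Rightarrow> ('x set \<Rightarrow> real) \<Rightarrow> bool" where
  "plausibility_measure X \<Sigma> \<gamma> \<longleftrightarrow>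
     algebra X \<Sigma> \<and>
     (\<forall>U\<in>\<Sigma>. 0 \<le> \<gamma> U \<and> \<gamma> U \<le> 1) \<and>
     \<gamma> {} = 0 \<and> \<gamma> X = 1 \<and>
     (\<forall>n\<ge>1. \<forall>U :: nat \<Rightarrow> 'x set. (\<forall>i\<in>{1..n}. U i \<in> \<Sigma>) \<longrightarrow>
        \<gamma> (\<Inter>i\<in>{1..n}. U i)
          \<le> (\<Sum>I\<in>Pow {1..n} - {{}}. (-1) ^ (card I + 1) * \<gamma> (\<Union>i\<in>I. U i)))"

section \<open>Uncertainty polynomial functors\<close>

text \<open>The functors are represented by the expressions that build them, because ingredients and
  sorts are defined by recursion on that construction. A constant functor carries its space
  \<open>(M, \<Sigma>\<^sub>M)\<close>; all the (finitely many) spaces of a functor live in one type \<open>'m\<close>, which is no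
  restriction since \<open>'m\<close> is arbitrary.\<close>

datatype measure_kind = Upper | Probability | Plausibility | Possibility

datatype 'm ufunctor =
    FId
  | FConst "'m set" "'m set set"
  | FProd "'m ufunctor" "'m ufunctor"
  | FSum "'m ufunctor" "'m ufunctor"
  | FDelta measure_kind "'m ufunctor"

abbreviation "FUpper \<equiv> FDelta Upper"
abbreviation "FProb \<equiv> FDelta Probability"
abbreviation "FPl \<equiv> FDelta Plausibility"
abbreviation "FPs \<equiv> FDelta Possibility"

primrec uncertainty_polynomial_functor :: "'m ufunctor \<Rightarrow> bool" where
  "uncertainty_polynomial_functor FId \<longleftrightarrow> True"
| "uncertainty_polynomial_functor (FConst M \<Sigma>) \<longleftrightarrow> algebra M \<Sigma>"
| "uncertainty_polynomial_functor (FProd S1 S2) \<longleftrightarrow>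
     uncertainty_polynomial_functor S1 \<and> uncertainty_polynomial_functor S2"
| "uncertainty_polynomial_functor (FSum S1 S2) \<longleftrightarrow>
     uncertainty_polynomial_functor S1 \<and> uncertainty_polynomial_functor S2"
| "uncertainty_polynomial_functor (FDelta K S) \<longleftrightarrow> uncertainty_polynomial_functor S"

primrec Ing :: "'m ufunctor \<Rightarrow> 'm ufunctor set" where
  "Ing FId = {FId}"
| "Ing (FConst M \<Sigma>) = {FConst M \<Sigma>, FId}"
| "Ing (FProd S1 S2) = {FProd S1 S2} \<union> Ing S1 \<union> Ing S2"
| "Ing (FSum S1 S2) = {FSum S1 S2} \<union> Ing S1 \<union> Ing S2"
| "Ing (FDelta K S) = {FDelta K S} \<union> Ing S"

section \<open>Formulas\<close>

datatype label = Pr1 | Pr2 | In1 | In2 | Next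

text \<open>Raw formulas. The sort index of \<open>\<bottom>\<^sub>S\<close> is dropped: a raw formula may belong to several sorts,
  but at a given sort the sorts of all its subformulas are determined, and everything below is
  indexed by the sort. \<open>Cst M \<Sigma> A\<close> is the constant formula \<open>A\<close> of the sort \<open>(M, \<Sigma>)\<close>.
  \<open>UpperBox p q\<close>, \<open>PlBox p q\<close>, \<open>PsBox p q\<close> are \<open>[(p,q)]\<close>, \<open>[(p,q)]\<^sub>P\<^sub>l\<close>, \<open>[(p,q)]\<^sub>P\<^sub>s\<close>.\<close>

datatype 'm formula =
    Bot
  | Imp "'m formula" "'m formula"  (infixr "\<^bold>\<longrightarrow>" 55)
  | Cst "'m set" "'m set set" "'m set"
  | Box label "'m formula"
  | UpperBox real real "'m formula"
  | P_ge real "'m formula"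
  | PlBox real real "'m formula"
  | PsBox real real "'m formula"

definition Neg :: "'m formula \<Rightarrow> 'm formula"  ("\<^bold>\<not> _" [70] 70) where
  "\<^bold>\<not> \<phi> = (\<phi> \<^bold>\<longrightarrow> Bot)"

definition Top :: "'m formula" where
  "Top = \<^bold>\<not> Bot"

definition Or :: "'m formula \<Rightarrow> 'm formula \<Rightarrow> 'm formula"  (infixr "\<^bold>\<or>" 60) where
  "\<phi> \<^bold>\<or> \<psi> = (\<^bold>\<not> \<phi> \<^bold>\<longrightarrow> \<psi>)"

definition And :: "'m formula \<Rightarrow> 'm formula \<Rightarrow> 'm formula"  (infixr "\<^bold>\<and>" 65) where
  "\<phi> \<^bold>\<and> \<psi> = \<^bold>\<not> (\<phi> \<^bold>\<longrightarrow> \<^bold>\<not> \<psi>)"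

definition Iff :: "'m formula \<Rightarrow> 'm formula \<Rightarrow> 'm formula"  (infix "\<^bold>\<longleftrightarrow>" 53) where
  "\<phi> \<^bold>\<longleftrightarrow> \<psi> = (\<phi> \<^bold>\<longrightarrow> \<psi>) \<^bold>\<and> (\<psi> \<^bold>\<longrightarrow> \<phi>)"

text \<open>Conjunctions and disjunctions over a finite index set, in the order of a fixed but
  unspecified enumeration (different orders give tautologically equivalent formulas).\<close>

definition enumeration :: "'i set \<Rightarrow> 'i list" where
  "enumeration A = (SOME xs. set xs = A \<and> distinct xs)"

definition BigAnd :: "'i set \<Rightarrow> ('i \<Rightarrow> 'm formula) \<Rightarrow> 'm formula" where
  "BigAnd A f = foldr (\<lambda>i \<phi>. f i \<^bold>\<and> \<phi>) (enumeration A) Top"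

definition BigOr :: "'i set \<Rightarrow> ('i \<Rightarrow> 'm formula) \<Rightarrow> 'm formula" where
  "BigOr A f = foldr (\<lambda>i \<phi>. f i \<^bold>\<or> \<phi>) (enumeration A) Bot"

definition "U_ge p \<phi> = UpperBox p 0 \<phi>"
definition "L_ge p \<phi> = UpperBox 0 p \<phi>"
definition "U_le p \<phi> = UpperBox 0 (1 - p) (\<^bold>\<not> \<phi>)"
definition "U_lt p \<phi> = \<^bold>\<not> (U_ge p \<phi>)"

definition "P_lt p \<phi> = \<^bold>\<not> (P_ge p \<phi>)"
definition "P_le p \<phi> = P_ge (1 - p) (\<^bold>\<not> \<phi>)"

definition "Pl_ge p \<phi> = PlBox p 0 \<phi>"
definition "Bel_ge p \<phi> = PlBox 0 p \<phi>"
definition "Pl_le p \<phi> = PlBox 0 (1 - p) (\<^bold>\<not> \<phi>)"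
definition "Bel_le p \<phi> = PlBox (1 - p) 0 (\<^bold>\<not> \<phi>)"
definition "Pl_lt p \<phi> = \<^bold>\<not> (Pl_ge p \<phi>)"

definition "Ps_ge p \<phi> = PsBox p 0 \<phi>"
definition "N_ge p \<phi> = PsBox 0 p \<phi>"
definition "Ps_le p \<phi> = PsBox 0 (1 - p) (\<^bold>\<not> \<phi>)"
definition "N_le p \<phi> = PsBox (1 - p) 0 (\<^bold>\<not> \<phi>)"
definition "Ps_lt p \<phi> = \<^bold>\<not> (Ps_ge p \<phi>)"

text \<open>\<open>Pl_alt i p\<close> is \<open>Pl\<^bsub>[i]p\<^esub>\<close>.\<close>

definition "Pl_alt i p \<phi> = (if odd (i::nat) then Pl_le p \<phi> else Pl_ge p \<phi>)"

text \<open>\<open>label_sort T \<kappa> S S'\<close>: the modality \<open>[\<kappa>]\<close> turns formulas of sort \<open>S'\<close> into formulas of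
  sort \<open>S\<close>.\<close>

inductive label_sort ::
  "'m ufunctor \<Rightarrow> label \<Rightarrow> 'm ufunctor \<Rightarrow> 'm ufunctor \<Rightarrow> bool" for T where
  "label_sort T Pr1 (FProd S1 S2) S1"
| "label_sort T Pr2 (FProd S1 S2) S2"
| "label_sort T In1 (FSum S1 S2) S1"
| "label_sort T In2 (FSum S1 S2) S2"
| "label_sort T Next FId T"

primrec measurable_constants :: "'m formula \<Rightarrow> bool" where
  "measurable_constants Bot \<longleftrightarrow> True"
| "measurable_constants (\<phi> \<^bold>\<longrightarrow> \<psi>) \<longleftrightarrow> measurable_constants \<phi> \<and> measurable_constants \<psi>"
| "measurable_constants (Cst M \<Sigma> A) \<longleftrightarrow> A \<in> \<Sigma>"
| "measurable_constants (Box \<kappa> \<phi>) \<longleftrightarrow> measurable_constants \<phi>"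
| "measurable_constants (UpperBox p q \<phi>) \<longleftrightarrow> measurable_constants \<phi>"
| "measurable_constants (P_ge p \<phi>) \<longleftrightarrow> measurable_constants \<phi>"
| "measurable_constants (PlBox p q \<phi>) \<longleftrightarrow> measurable_constants \<phi>"
| "measurable_constants (PsBox p q \<phi>) \<longleftrightarrow> measurable_constants \<phi>"

inductive has_sort :: "'m ufunctor \<Rightarrow> 'm formula \<Rightarrow> 'm ufunctor \<Rightarrow> bool" for T where
  "has_sort T Bot S"
| "has_sort T \<phi> S \<Longrightarrow> has_sort T \<psi> S \<Longrightarrow> has_sort T (\<phi> \<^bold>\<longrightarrow> \<psi>) S"
| "A \<in> \<Sigma> \<or> (\<exists>m\<in>M. A = {m}) \<Longrightarrow> has_sort T (Cst M \<Sigma> A) (FConst M \<Sigma>)"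
| "label_sort T \<kappa> S S' \<Longrightarrow> has_sort T \<phi> S' \<Longrightarrow> has_sort T (Box \<kappa> \<phi>) S"
| "has_sort T \<phi> S \<Longrightarrow> measurable_constants \<phi> \<Longrightarrow> p \<in> {0..1} \<Longrightarrow> q \<in> {0..1} \<Longrightarrow>
     has_sort T (UpperBox p q \<phi>) (FUpper S)"
| "has_sort T \<phi> S \<Longrightarrow> measurable_constants \<phi> \<Longrightarrow> p \<in> {0..1} \<Longrightarrow>
     has_sort T (P_ge p \<phi>) (FProb S)"
| "has_sort T \<phi> S \<Longrightarrow> measurable_constants \<phi> \<Longrightarrow> p \<in> {0..1} \<Longrightarrow> q \<in> {0..1} \<Longrightarrow>
     has_sort T (PlBox p q \<phi>) (FPl S)"
| "has_sort T \<phi> S \<Longrightarrow> measurable_constants \<phi> \<Longrightarrow> p \<in> {0..1} \<Longrightarrow> q \<in> {0..1} \<Longrightarrow>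
     has_sort T (PsBox p q \<phi>) (FPs S)"

definition Form :: "'m ufunctor \<Rightarrow> 'm ufunctor \<Rightarrow> 'm formula set" where
  "Form T S = {\<phi>. has_sort T \<phi> S}"

text \<open>\<open>\<phi> \<in> MForm T S\<close> is \<open>\<phi> :: S\<close>.\<close>

definition MForm :: "'m ufunctor \<Rightarrow> 'm ufunctor \<Rightarrow> 'm formula set" where
  "MForm T S = {\<phi> \<in> Form T S. measurable_constants \<phi>}"

section \<open>Axioms\<close>

text \<open>Boolean tautologies are substitution instances of propositional tautologies: every formula
  that is neither \<open>\<bottom>\<close> nor an implication counts as an atom.\<close>

fun bool_value :: "('m formula \<Rightarrow> bool) \<Rightarrow> 'm formula \<Rightarrow> bool" where
  "bool_value v Bot \<longleftrightarrow> False"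
| "bool_value v (\<phi> \<^bold>\<longrightarrow> \<psi>) \<longleftrightarrow> (bool_value v \<phi> \<longrightarrow> bool_value v \<psi>)"
| "bool_value v \<phi> \<longleftrightarrow> v \<phi>"

definition tautology :: "'m formula \<Rightarrow> bool" where
  "tautology \<phi> \<longleftrightarrow> (\<forall>v. bool_value v \<phi>)"

abbreviation nonempty_subsets :: "nat \<Rightarrow> nat set set" where
  "nonempty_subsets n \<equiv> Pow {1..n} - {{}}"

inductive Ax :: "'m ufunctor \<Rightarrow> 'm ufunctor \<Rightarrow> 'm formula \<Rightarrow> bool" for T where
  taut: "\<phi> \<in> Form T S \<Longrightarrow> tautology \<phi> \<Longrightarrow> Ax T S \<phi>"
| const_in: "c \<in> M \<Longrightarrow> Cst M \<Sigma> A \<in> Form T (FConst M \<Sigma>) \<Longrightarrow> c \<in> A \<Longrightarrow>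
    Ax T (FConst M \<Sigma>) (Cst M \<Sigma> {c} \<^bold>\<longrightarrow> Cst M \<Sigma> A)"
| const_notin: "c \<in> M \<Longrightarrow> Cst M \<Sigma> A \<in> Form T (FConst M \<Sigma>) \<Longrightarrow> c \<notin> A \<Longrightarrow>
    Ax T (FConst M \<Sigma>) (Cst M \<Sigma> {c} \<^bold>\<longrightarrow> \<^bold>\<not> (Cst M \<Sigma> A))"
| box_neg: "label_sort T \<kappa> S S' \<Longrightarrow> \<phi> \<in> Form T S' \<Longrightarrow>
    Ax T S (\<^bold>\<not> (Box \<kappa> \<phi>) \<^bold>\<longrightarrow> Box \<kappa> (\<^bold>\<not> \<phi>))"
| pr_bot: "\<kappa> \<in> {Pr1, Pr2} \<Longrightarrow> Ax T (FProd S1 S2) (\<^bold>\<not> (Box \<kappa> Bot))"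
| in_bot: "Ax T (FSum S1 S2) (\<^bold>\<not> (Box In1 Bot) \<^bold>\<longleftrightarrow> Box In2 Bot)"
| next_bot: "Ax T FId (\<^bold>\<not> (Box Next Bot))"
| U_le_lt: "\<phi> \<in> MForm T S \<Longrightarrow> p \<in> {0..1} \<Longrightarrow> q \<in> {0..1} \<Longrightarrow> p < q \<Longrightarrow>
    Ax T (FUpper S) (U_le p \<phi> \<^bold>\<longrightarrow> U_lt q \<phi>)"
| U_lt_le: "\<phi> \<in> MForm T S \<Longrightarrow> p \<in> {0..1} \<Longrightarrow>
    Ax T (FUpper S) (U_lt p \<phi> \<^bold>\<longrightarrow> U_le p \<phi>)"
| U_mono: "\<phi> \<in> MForm T S \<Longrightarrow> \<psi> \<in> MForm T S \<Longrightarrow> p \<in> {0..1} \<Longrightarrow>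
    Ax T (FUpper S) (L_ge 1 (\<phi> \<^bold>\<longrightarrow> \<psi>) \<^bold>\<longrightarrow> (U_ge p \<phi> \<^bold>\<longrightarrow> U_ge p \<psi>))"
| U_box: "\<phi> \<in> MForm T S \<Longrightarrow> p \<in> {0..1} \<Longrightarrow> q \<in> {0..1} \<Longrightarrow>
    Ax T (FUpper S) (UpperBox p q \<phi> \<^bold>\<longleftrightarrow> (U_ge p \<phi> \<^bold>\<and> L_ge q \<phi>))"
| P_le_lt: "\<phi> \<in> MForm T S \<Longrightarrow> p \<in> {0..1} \<Longrightarrow> q \<in> {0..1} \<Longrightarrow> p < q \<Longrightarrow>
    Ax T (FProb S) (P_le p \<phi> \<^bold>\<longrightarrow> P_lt q \<phi>)"
| P_lt_le: "\<phi> \<in> MForm T S \<Longrightarrow> p \<in> {0..1} \<Longrightarrow>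
    Ax T (FProb S) (P_lt p \<phi> \<^bold>\<longrightarrow> P_le p \<phi>)"
| P_mono: "\<phi> \<in> MForm T S \<Longrightarrow> \<psi> \<in> MForm T S \<Longrightarrow> p \<in> {0..1} \<Longrightarrow>
    Ax T (FProb S) (P_ge 1 (\<phi> \<^bold>\<longrightarrow> \<psi>) \<^bold>\<longrightarrow> (P_ge p \<phi> \<^bold>\<longrightarrow> P_ge p \<psi>))"
| Pl_le_lt: "\<phi> \<in> MForm T S \<Longrightarrow> p \<in> {0..1} \<Longrightarrow> q \<in> {0..1} \<Longrightarrow> p < q \<Longrightarrow>
    Ax T (FPl S) (Pl_le p \<phi> \<^bold>\<longrightarrow> Pl_lt q \<phi>)"
| Pl_lt_le: "\<phi> \<in> MForm T S \<Longrightarrow> p \<in> {0..1} \<Longrightarrow>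
    Ax T (FPl S) (Pl_lt p \<phi> \<^bold>\<longrightarrow> Pl_le p \<phi>)"
| Pl_Bel: "\<phi> \<in> MForm T S \<Longrightarrow> p \<in> {0..1} \<Longrightarrow>
    Ax T (FPl S) (Pl_le p \<phi> \<^bold>\<longrightarrow> Bel_le p \<phi>)"
| Pl_mono: "\<phi> \<in> MForm T S \<Longrightarrow> \<psi> \<in> MForm T S \<Longrightarrow> p \<in> {0..1} \<Longrightarrow>
    Ax T (FPl S) (Bel_ge 1 (\<phi> \<^bold>\<longrightarrow> \<psi>) \<^bold>\<longrightarrow> (Pl_ge p \<phi> \<^bold>\<longrightarrow> Pl_ge p \<psi>))"
| Pl_box: "\<phi> \<in> MForm T S \<Longrightarrow> p \<in> {0..1} \<Longrightarrow> q \<in> {0..1} \<Longrightarrow>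
    Ax T (FPl S) (PlBox p q \<phi> \<^bold>\<longleftrightarrow> (Pl_ge p \<phi> \<^bold>\<and> Bel_ge q \<phi>))"
| Pl_incl_excl: "n \<ge> 1 \<Longrightarrow> (\<forall>i\<in>{1..n}. \<phi> i \<in> MForm T S) \<Longrightarrow>
    (\<forall>I\<in>nonempty_subsets n. p I \<in> {0..1}) \<Longrightarrow>
    q = (\<Sum>I\<in>nonempty_subsets n. (-1) ^ (card I + 1) * p I) \<Longrightarrow> q \<ge> 0 \<Longrightarrow>
    Ax T (FPl S)
      (BigAnd (nonempty_subsets n) (\<lambda>I. Pl_alt (card I) (p I) (BigOr I \<phi>))
        \<^bold>\<longrightarrow> Pl_le (min q 1) (BigAnd {1..n} \<phi>))"
| Pl_incl_excl_neg: "n \<ge> 1 \<Longrightarrow> (\<forall>i\<in>{1..n}. \<phi> i \<in> MForm T S) \<Longrightarrow>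
    (\<forall>I\<in>nonempty_subsets n. p I \<in> {0..1}) \<Longrightarrow>
    q = (\<Sum>I\<in>nonempty_subsets n. (-1) ^ (card I + 1) * p I) \<Longrightarrow> q < 0 \<Longrightarrow>
    Ax T (FPl S)
      (\<^bold>\<not> (BigAnd (nonempty_subsets n) (\<lambda>I. Pl_alt (card I) (p I) (BigOr I \<phi>))))"
| Ps_le_lt: "\<phi> \<in> MForm T S \<Longrightarrow> p \<in> {0..1} \<Longrightarrow> q \<in> {0..1} \<Longrightarrow> p < q \<Longrightarrow>
    Ax T (FPs S) (Ps_le p \<phi> \<^bold>\<longrightarrow> Ps_lt q \<phi>)"
| Ps_lt_le: "\<phi> \<in> MForm T S \<Longrightarrow> p \<in> {0..1} \<Longrightarrow>
    Ax T (FPs S) (Ps_lt p \<phi> \<^bold>\<longrightarrow> Ps_le p \<phi>)"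
| Ps_bot: "Ax T (FPs S) (Ps_le 0 Bot)"
| Ps_N: "\<phi> \<in> MForm T S \<Longrightarrow> p \<in> {0..1} \<Longrightarrow>
    Ax T (FPs S) (Ps_le p \<phi> \<^bold>\<longrightarrow> N_le p \<phi>)"
| Ps_max: "\<phi> \<in> MForm T S \<Longrightarrow> \<psi> \<in> MForm T S \<Longrightarrow> p \<in> {0..1} \<Longrightarrow> q \<in> {0..1} \<Longrightarrow>
    Ax T (FPs S) ((Ps_le p \<phi> \<^bold>\<and> Ps_le q \<psi>) \<^bold>\<longrightarrow> Ps_le (max p q) (\<phi> \<^bold>\<or> \<psi>))"
| Ps_mono: "\<phi> \<in> MForm T S \<Longrightarrow> \<psi> \<in> MForm T S \<Longrightarrow> p \<in> {0..1} \<Longrightarrow>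
    Ax T (FPs S) (N_ge 1 (\<phi> \<^bold>\<longrightarrow> \<psi>) \<^bold>\<longrightarrow> (Ps_ge p \<phi> \<^bold>\<longrightarrow> Ps_ge p \<psi>))"
| Ps_box: "\<phi> \<in> MForm T S \<Longrightarrow> p \<in> {0..1} \<Longrightarrow> q \<in> {0..1} \<Longrightarrow>
    Ax T (FPs S) (PsBox p q \<phi> \<^bold>\<longleftrightarrow> (Ps_ge p \<phi> \<^bold>\<and> N_ge q \<phi>))"

section \<open>Deduction systems\<close>

text \<open>\<open>Cover m k \<phi>\<close> says that at least \<open>k\<close> of \<open>\<phi>\<^sub>1, \<dots>, \<phi>\<^sub>m\<close> hold.\<close>

definition Cover :: "nat \<Rightarrow> nat \<Rightarrow> (nat \<Rightarrow> 'm formula) \<Rightarrow> 'm formula" where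
  "Cover m k \<phi> = BigOr {I. I \<subseteq> {1..m} \<and> card I = k} (\<lambda>I. BigAnd I \<phi>)"

text \<open>\<open>D S \<Gamma> \<phi>\<close> is \<open>\<Gamma> \<turnstile>\<^sub>S \<phi>\<close>; only the values at sorts \<open>S \<in> Ing T\<close> matter.\<close>

locale deduction_system =
  fixes T :: "'m ufunctor"
    and D :: "'m ufunctor \<Rightarrow> 'm formula set \<Rightarrow> 'm formula \<Rightarrow> bool"
  assumes well_sorted:
      "\<lbrakk>S \<in> Ing T; D S \<Gamma> \<phi>\<rbrakk> \<Longrightarrow> \<Gamma> \<subseteq> Form T S \<and> \<phi> \<in> Form T S"
    and assumption:
      "\<lbrakk>S \<in> Ing T; \<Gamma> \<subseteq> Form T S; \<phi> \<in> \<Gamma> \<or> Ax T S \<phi>\<rbrakk> \<Longrightarrow> D S \<Gamma> \<phi>"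
    and modus_ponens:
      "\<lbrakk>S \<in> Ing T; \<phi> \<in> Form T S; \<psi> \<in> Form T S\<rbrakk> \<Longrightarrow> D S {\<phi>, \<phi> \<^bold>\<longrightarrow> \<psi>} \<psi>"
    and cut:
      "\<lbrakk>S \<in> Ing T; \<Gamma> \<subseteq> Form T S; \<forall>\<psi>\<in>\<Lambda>. D S \<Gamma> \<psi>; D S \<Lambda> \<phi>\<rbrakk> \<Longrightarrow> D S \<Gamma> \<phi>"
    and deduction:
      "\<lbrakk>S \<in> Ing T; D S (insert \<phi> \<Gamma>) \<psi>\<rbrakk> \<Longrightarrow> D S \<Gamma> (\<phi> \<^bold>\<longrightarrow> \<psi>)"
    and constant_rule:
      "FConst M \<Sigma> \<in> Ing T \<Longrightarrow> D (FConst M \<Sigma>) {\<^bold>\<not> (Cst M \<Sigma> {c}) |c. c \<in> M} Bot"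
    and definite_box:
      "\<lbrakk>S \<in> Ing T; S' \<in> Ing T; label_sort T \<kappa> S S'; D S' \<Gamma> \<psi>\<rbrakk>
        \<Longrightarrow> D S (Box \<kappa> ` \<Gamma>) (Box \<kappa> \<psi>)"
    and necessitation_L:
      "\<lbrakk>FUpper S \<in> Ing T; \<phi> \<in> MForm T S; D S {} \<phi>\<rbrakk> \<Longrightarrow> D (FUpper S) {} (L_ge 1 \<phi>)"
    and necessitation_P:
      "\<lbrakk>FProb S \<in> Ing T; \<phi> \<in> MForm T S; D S {} \<phi>\<rbrakk> \<Longrightarrow> D (FProb S) {} (P_ge 1 \<phi>)"
    and necessitation_Bel:
      "\<lbrakk>FPl S \<in> Ing T; \<phi> \<in> MForm T S; D S {} \<phi>\<rbrakk> \<Longrightarrow> D (FPl S) {} (Bel_ge 1 \<phi>)"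
    and necessitation_N:
      "\<lbrakk>FPs S \<in> Ing T; \<phi> \<in> MForm T S; D S {} \<phi>\<rbrakk> \<Longrightarrow> D (FPs S) {} (N_ge 1 \<phi>)"
    and archimedean_Upper:
      "\<lbrakk>FUpper S \<in> Ing T; \<psi> \<in> MForm T S; p \<in> {0..1}; Oge \<in> {U_ge, L_ge}\<rbrakk>
        \<Longrightarrow> D (FUpper S) {Oge q \<psi> |q. q \<in> {0..1} \<and> q < p} (Oge p \<psi>)"
    and archimedean_P:
      "\<lbrakk>FProb S \<in> Ing T; \<psi> \<in> MForm T S; p \<in> {0..1}\<rbrakk>
        \<Longrightarrow> D (FProb S) {P_ge q \<psi> |q. q \<in> {0..1} \<and> q < p} (P_ge p \<psi>)"
    and archimedean_Pl:
      "\<lbrakk>FPl S \<in> Ing T; \<psi> \<in> MForm T S; p \<in> {0..1}; Oge \<in> {Pl_ge, Bel_ge}\<rbrakk>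
        \<Longrightarrow> D (FPl S) {Oge q \<psi> |q. q \<in> {0..1} \<and> q < p} (Oge p \<psi>)"
    and archimedean_Ps:
      "\<lbrakk>FPs S \<in> Ing T; \<psi> \<in> MForm T S; p \<in> {0..1}; Oge \<in> {Ps_ge, N_ge}\<rbrakk>
        \<Longrightarrow> D (FPs S) {Oge q \<psi> |q. q \<in> {0..1} \<and> q < p} (Oge p \<psi>)"
    and cover1:
      "\<lbrakk>(K, Ole) \<in> {(Upper, U_le), (Probability, P_le)}; FDelta K S \<in> Ing T; n \<ge> 1;
        \<phi> \<in> MForm T S; \<forall>i\<in>{1..m}. \<phi>s i \<in> MForm T S; \<forall>i\<in>{1..m}. r i \<in> {0..1};
        D S {} (\<phi> \<^bold>\<longrightarrow> Cover m (n + k) \<phi>s); D S {} (Cover m k \<phi>s);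
        p = max 0 (min 1 (((\<Sum>i\<in>{1..m}. r i) - real k) / real n))\<rbrakk>
        \<Longrightarrow> D (FDelta K S) {} (BigAnd {1..m} (\<lambda>i. Ole (r i) (\<phi>s i)) \<^bold>\<longrightarrow> Ole p \<phi>)"
    and cover2:
      "\<lbrakk>(K, Ole) \<in> {(Upper, U_le), (Probability, P_le)}; FDelta K S \<in> Ing T;
        \<forall>i\<in>{1..m}. \<phi>s i \<in> MForm T S; \<forall>i\<in>{1..m}. r i \<in> {0..1};
        D S {} (Cover m k \<phi>s); (\<Sum>i\<in>{1..m}. r i) < real k\<rbrakk>
        \<Longrightarrow> D (FDelta K S) {} (\<^bold>\<not> (BigAnd {1..m} (\<lambda>i. Ole (r i) (\<phi>s i))))"

definition consistent ::
  "('m ufunctor \<Rightarrow> 'm formula set \<Rightarrow> 'm formula \<Rightarrow> bool) \<Rightarrow> 'm ufunctor \<Rightarrow> 'm formula set \<Rightarrow> bool"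
where
  "consistent D S \<Gamma> \<longleftrightarrow> \<not> D S \<Gamma> Bot"

text \<open>\<open>Max_sets T D S\<close> is the set \<open>X\<^sub>S\<close> of \<open>\<turnstile>\<^sub>S\<close>-maximal sets.\<close>

definition Max_sets ::
  "'m ufunctor \<Rightarrow> ('m ufunctor \<Rightarrow> 'm formula set \<Rightarrow> 'm formula \<Rightarrow> bool) \<Rightarrow> 'm ufunctor \<Rightarrow>
    'm formula set set"
where
  "Max_sets T D S = {\<Gamma>. \<Gamma> \<subseteq> Form T S \<and> consistent D S \<Gamma> \<and>
     (\<forall>\<phi>\<in>Form T S. \<phi> \<in> \<Gamma> \<longleftrightarrow> \<^bold>\<not> \<phi> \<notin> \<Gamma>)}"

definition lindenbaum ::
  "'m ufunctor \<Rightarrow> ('m ufunctor \<Rightarrow> 'm formula set \<Rightarrow> 'm formula \<Rightarrow> bool) \<Rightarrow> bool"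
where
  "lindenbaum T D \<longleftrightarrow>
     (\<forall>S\<in>Ing T. \<forall>\<Gamma>\<subseteq>Form T S. consistent D S \<Gamma> \<longrightarrow> (\<exists>\<Delta>\<in>Max_sets T D S. \<Gamma> \<subseteq> \<Delta>))"

text \<open>\<open>ext T D S \<phi>\<close> is \<open>|\<phi>|\<^sub>S\<close> and \<open>ext_algebra T D S\<close> is \<open>\<Sigma>\<^sub>S\<close>.\<close>

definition ext ::
  "'m ufunctor \<Rightarrow> ('m ufunctor \<Rightarrow> 'm formula set \<Rightarrow> 'm formula \<Rightarrow> bool) \<Rightarrow> 'm ufunctor \<Rightarrow>
    'm formula \<Rightarrow> 'm formula set set"
where
  "ext T D S \<phi> = {y \<in> Max_sets T D S. \<phi> \<in> y}"

definition ext_algebra ::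
  "'m ufunctor \<Rightarrow> ('m ufunctor \<Rightarrow> 'm formula set \<Rightarrow> 'm formula \<Rightarrow> bool) \<Rightarrow> 'm ufunctor \<Rightarrow>
    'm formula set set set"
where
  "ext_algebra T D S = ext T D S ` MForm T S"

definition pl_sup :: "'m formula set \<Rightarrow> 'm formula \<Rightarrow> real" where
  "pl_sup x \<phi> = Sup {q \<in> {0..1}. Pl_ge q \<phi> \<in> x}"

text \<open>The value \<open>\<gamma>\<^sub>x(|\<phi>|\<^sub>S)\<close> is \<open>pl_sup x \<phi>\<close>; the description is meaningful only once this is known
  to depend on \<open>|\<phi>|\<^sub>S\<close> alone.\<close>

definition canonical_pl ::
  "'m ufunctor \<Rightarrow> ('m ufunctor \<Rightarrow> 'm formula set \<Rightarrow> 'm formula \<Rightarrow> bool) \<Rightarrow> 'm ufunctor \<Rightarrow>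
    'm formula set \<Rightarrow> 'm formula set set \<Rightarrow> real"
where
  "canonical_pl T D S x U = (THE r. \<exists>\<phi>\<in>MForm T S. ext T D S \<phi> = U \<and> r = pl_sup x \<phi>)"

end

theory Submission
  imports Defs
begin

text \<open>Write \<open>g \<phi>\<close> for \<open>pl_sup x \<phi>\<close>. The Archimedean rules make the suprema attained, so that
  membership of \<open>Pl\<^bsub>\<ge>p\<^esub>\<phi>\<close> and \<open>Pl\<^bsub>\<le>p\<^esub>\<phi>\<close> in \<open>x\<close> means exactly \<open>p \<le> g \<phi>\<close> and \<open>g \<phi> \<le> p\<close>. By the
  Lindenbaum property an inclusion \<open>|\<phi>| \<subseteq> |\<psi>|\<close> yields \<open>\<turnstile> \<phi> \<rightarrow> \<psi>\<close>, and necessitation with the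
  monotonicity axiom gives \<open>g \<phi> \<le> g \<psi>\<close>. Choosing \<open>p\<^sub>I = g (\<psi>\<^sub>I)\<close> puts all conjuncts of
  the inclusion-exclusion axioms into \<open>x\<close>: the negative case contradicts consistency, and the
  other one is the plausibility inequality.\<close>

section \<open>Sorts\<close>

lemma self_in_Ing: "S \<in> Ing S"
  by (cases S) auto

text \<open>Gives access to the rules of \<open>D\<close> at the base sort, where
  \<open>\<phi>\<close> and its extension live, from the sort at which \<open>x\<close>
  lives.\<close>

lemma FDelta_Ing: "FDelta K S \<in> Ing T \<Longrightarrow> S \<in> Ing T"
  by (induction T) (auto simp: self_in_Ing)

inductive_simps has_sort_Imp: "has_sort T (\<phi> \<^bold>\<longrightarrow> \<psi>) S"
inductive_simps has_sort_PlBox: "has_sort T (PlBox p q \<phi>) (FPl S)"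

section \<open>Formation rules for sorted formulas and for those with measurable constants\<close>

lemma Form_Bot [simp]: "Bot \<in> Form T S"
  by (simp add: Form_def has_sort.intros)

lemma Form_Imp [simp]: "(\<phi> \<^bold>\<longrightarrow> \<psi>) \<in> Form T S \<longleftrightarrow> \<phi> \<in> Form T S \<and> \<psi> \<in> Form T S"
  by (simp add: Form_def has_sort_Imp)

lemma Form_Neg [simp]: "(\<^bold>\<not> \<phi>) \<in> Form T S \<longleftrightarrow> \<phi> \<in> Form T S"
  by (simp add: Neg_def)

lemma Form_Or [simp]: "(\<phi> \<^bold>\<or> \<psi>) \<in> Form T S \<longleftrightarrow> \<phi> \<in> Form T S \<and> \<psi> \<in> Form T S"
  by (simp add: Or_def)

lemma Form_And [simp]: "(\<phi> \<^bold>\<and> \<psi>) \<in> Form T S \<longleftrightarrow> \<phi> \<in> Form T S \<and> \<psi> \<in> Form T S"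
  by (simp add: And_def)

lemma Form_PlBox [simp]:
  "PlBox p q \<phi> \<in> Form T (FPl S) \<longleftrightarrow> \<phi> \<in> MForm T S \<and> p \<in> {0..1} \<and> q \<in> {0..1}"
  by (auto simp: Form_def MForm_def has_sort_PlBox)

lemma MForm_Form: "\<phi> \<in> MForm T S \<Longrightarrow> \<phi> \<in> Form T S"
  by (simp add: MForm_def)

lemma MForm_Bot [simp]: "Bot \<in> MForm T S"
  by (simp add: MForm_def)

lemma MForm_Imp [simp]: "(\<phi> \<^bold>\<longrightarrow> \<psi>) \<in> MForm T S \<longleftrightarrow> \<phi> \<in> MForm T S \<and> \<psi> \<in> MForm T S"
  by (auto simp: MForm_def)

lemma MForm_Neg [simp]: "(\<^bold>\<not> \<phi>) \<in> MForm T S \<longleftrightarrow> \<phi> \<in> MForm T S"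
  by (simp add: Neg_def)

lemma MForm_Or [simp]: "(\<phi> \<^bold>\<or> \<psi>) \<in> MForm T S \<longleftrightarrow> \<phi> \<in> MForm T S \<and> \<psi> \<in> MForm T S"
  by (simp add: Or_def)

lemma MForm_And [simp]: "(\<phi> \<^bold>\<and> \<psi>) \<in> MForm T S \<longleftrightarrow> \<phi> \<in> MForm T S \<and> \<psi> \<in> MForm T S"
  by (simp add: And_def)

text \<open>The choice in \<open>enumeration\<close> is meaningful only for finite sets, where a
  distinct list of all elements exists.\<close>

lemma set_enumeration: "finite A \<Longrightarrow> set (enumeration A) = A"
  unfolding enumeration_def by (rule someI2_ex[OF finite_distinct_list]) auto

lemma foldr_Or_MForm:
  "(\<forall>i\<in>set xs. f i \<in> MForm T S) \<Longrightarrow> foldr (\<lambda>i \<phi>. f i \<^bold>\<or> \<phi>) xs Bot \<in> MForm T S"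
  by (induction xs) auto

lemma foldr_And_MForm:
  "(\<forall>i\<in>set xs. f i \<in> MForm T S) \<Longrightarrow> foldr (\<lambda>i \<phi>. f i \<^bold>\<and> \<phi>) xs Top \<in> MForm T S"
  by (induction xs) (auto simp: Top_def)

lemma foldr_Or_Form:
  "(\<forall>i\<in>set xs. f i \<in> Form T S) \<Longrightarrow> foldr (\<lambda>i \<phi>. f i \<^bold>\<or> \<phi>) xs Bot \<in> Form T S"
  by (induction xs) auto

lemma foldr_And_Form:
  "(\<forall>i\<in>set xs. f i \<in> Form T S) \<Longrightarrow> foldr (\<lambda>i \<phi>. f i \<^bold>\<and> \<phi>) xs Top \<in> Form T S"
  by (induction xs) (auto simp: Top_def)

lemma BigOr_MForm: "finite A \<Longrightarrow> \<forall>i\<in>A. f i \<in> MForm T S \<Longrightarrow> BigOr A f \<in> MForm T S"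
  by (simp add: BigOr_def foldr_Or_MForm set_enumeration)

lemma BigAnd_MForm: "finite A \<Longrightarrow> \<forall>i\<in>A. f i \<in> MForm T S \<Longrightarrow> BigAnd A f \<in> MForm T S"
  by (simp add: BigAnd_def foldr_And_MForm set_enumeration)

section \<open>Maximal sets\<close>

context deduction_system
begin

text \<open>Weakening is a case of cut: every formula of \<open>\<Lambda>\<close> is derivable from
  \<open>\<Gamma>\<close> by assumption.\<close>

lemma weakening:
  assumes "S \<in> Ing T" "D S \<Lambda> \<phi>" "\<Lambda> \<subseteq> \<Gamma>" "\<Gamma> \<subseteq> Form T S"
  shows "D S \<Gamma> \<phi>"
  using assms by (meson assumption cut subsetD)

lemma derive_mp:
  assumes "S \<in> Ing T" "D S \<Gamma> (\<phi> \<^bold>\<longrightarrow> \<psi>)" "D S \<Gamma> \<phi>"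
  shows "D S \<Gamma> \<psi>"
proof -
  have "\<Gamma> \<subseteq> Form T S" "\<phi> \<in> Form T S" "\<psi> \<in> Form T S"
    using well_sorted[OF assms(1,2)] by auto
  with assms modus_ponens[of S \<phi> \<psi>] cut[of S \<Gamma> "{\<phi>, \<phi> \<^bold>\<longrightarrow> \<psi>}" \<psi>] show ?thesis
    by blast
qed

section \<open>Deductive closure of maximal sets and their truth conditions\<close>

lemma maximal_subset: "y \<in> Max_sets T D S \<Longrightarrow> y \<subseteq> Form T S"
  by (simp add: Max_sets_def)

lemma maximal_consistent: "y \<in> Max_sets T D S \<Longrightarrow> \<not> D S y Bot"
  by (simp add: Max_sets_def consistent_def)

lemma maximal_Neg [simp]:
  "y \<in> Max_sets T D S \<Longrightarrow> \<phi> \<in> Form T S \<Longrightarrow> (\<^bold>\<not> \<phi>) \<in> y \<longleftrightarrow> \<phi> \<notin> y"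
  unfolding Max_sets_def by blast

text \<open>A derivable formula missing from \<open>y\<close> would have its negation in
  \<open>y\<close>, and then \<open>y\<close> would derive \<open>Bot\<close>.\<close>

lemma maximal_closed:
  assumes "S \<in> Ing T" "y \<in> Max_sets T D S" "D S y \<phi>"
  shows "\<phi> \<in> y"
proof (rule ccontr)
  assume "\<phi> \<notin> y"
  moreover have y: "y \<subseteq> Form T S" "\<not> D S y Bot"
    using assms(2) maximal_subset maximal_consistent by blast+
  moreover have "\<phi> \<in> Form T S"
    using well_sorted assms by blast
  ultimately have "(\<phi> \<^bold>\<longrightarrow> Bot) \<in> y"
    using maximal_Neg[OF assms(2)] by (simp add: Neg_def)
  then have "D S y (\<phi> \<^bold>\<longrightarrow> Bot)"
    using assumption assms(1) y(1) by blast
  then show False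
    using derive_mp assms y(2) by blast
qed

lemma maximal_theorem:
  assumes "S \<in> Ing T" "y \<in> Max_sets T D S" "D S {} \<phi>"
  shows "\<phi> \<in> y"
proof -
  have "y \<subseteq> Form T S"
    using assms(2) by (rule maximal_subset)
  with assms show ?thesis
    using weakening maximal_closed by blast
qed

lemma maximal_axiom:
  assumes "S \<in> Ing T" "y \<in> Max_sets T D S" "Ax T S \<phi>"
  shows "\<phi> \<in> y"
  using assms by (meson assumption empty_subsetI maximal_theorem)

lemma maximal_mp:
  assumes "S \<in> Ing T" "y \<in> Max_sets T D S" "(\<phi> \<^bold>\<longrightarrow> \<psi>) \<in> y" "\<phi> \<in> y"
  shows "\<psi> \<in> y"
proof -
  have "y \<subseteq> Form T S"
    using assms(2) by (rule maximal_subset)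
  with assms have "D S y (\<phi> \<^bold>\<longrightarrow> \<psi>)" "D S y \<phi>"
    using assumption by blast+
  with assms show ?thesis
    using derive_mp maximal_closed by blast
qed

lemma maximal_axiom_mp:
  assumes "S \<in> Ing T" "y \<in> Max_sets T D S" "Ax T S (\<phi> \<^bold>\<longrightarrow> \<psi>)" "\<phi> \<in> y"
  shows "\<psi> \<in> y"
  using assms maximal_axiom maximal_mp by blast

lemma maximal_Bot:
  assumes "S \<in> Ing T" "y \<in> Max_sets T D S"
  shows "Bot \<notin> y"
  using assms assumption[of S y Bot] maximal_subset maximal_consistent by metis

lemma maximal_Imp:
  assumes "S \<in> Ing T" "y \<in> Max_sets T D S" "\<phi> \<in> Form T S" "\<psi> \<in> Form T S"
  shows "(\<phi> \<^bold>\<longrightarrow> \<psi>) \<in> y \<longleftrightarrow> (\<phi> \<in> y \<longrightarrow> \<psi> \<in> y)"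
proof -
  \<comment> \<open>These tautologies settle the two ways in which a material implication can be
    true; the converse direction is modus ponens.\<close>
  have "Ax T S (\<psi> \<^bold>\<longrightarrow> \<phi> \<^bold>\<longrightarrow> \<psi>)" "Ax T S (\<^bold>\<not> \<phi> \<^bold>\<longrightarrow> \<phi> \<^bold>\<longrightarrow> \<psi>)"
    using assms by (auto intro!: Ax.taut simp: tautology_def Neg_def)
  then show ?thesis
    using assms maximal_axiom_mp maximal_mp maximal_Neg by metis
qed

lemma maximal_Or:
  assumes "S \<in> Ing T" "y \<in> Max_sets T D S" "\<phi> \<in> Form T S" "\<psi> \<in> Form T S"
  shows "(\<phi> \<^bold>\<or> \<psi>) \<in> y \<longleftrightarrow> \<phi> \<in> y \<or> \<psi> \<in> y"
  using assms by (auto simp: Or_def maximal_Imp)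

lemma maximal_And:
  assumes "S \<in> Ing T" "y \<in> Max_sets T D S" "\<phi> \<in> Form T S" "\<psi> \<in> Form T S"
  shows "(\<phi> \<^bold>\<and> \<psi>) \<in> y \<longleftrightarrow> \<phi> \<in> y \<and> \<psi> \<in> y"
  using assms by (auto simp: And_def maximal_Imp)

lemma maximal_BigOr:
  assumes "S \<in> Ing T" "y \<in> Max_sets T D S" "finite A" "\<forall>i\<in>A. f i \<in> Form T S"
  shows "BigOr A f \<in> y \<longleftrightarrow> (\<exists>i\<in>A. f i \<in> y)"
proof -
  \<comment> \<open>The induction ranges over arbitrary lists, because \<open>enumeration A\<close>
    is an unspecified list without recursive structure.\<close>
  have "foldr (\<lambda>i \<phi>. f i \<^bold>\<or> \<phi>) xs Bot \<in> y \<longleftrightarrow> (\<exists>i\<in>set xs. f i \<in> y)"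
    if "\<forall>i\<in>set xs. f i \<in> Form T S" for xs
    using that
    by (induction xs) (auto simp: maximal_Or[OF assms(1,2)] maximal_Bot[OF assms(1,2)] foldr_Or_Form)
  from this[of "enumeration A"] assms(3,4) show ?thesis
    by (simp add: BigOr_def set_enumeration)
qed

lemma maximal_BigAnd:
  assumes "S \<in> Ing T" "y \<in> Max_sets T D S" "finite A" "\<forall>i\<in>A. f i \<in> Form T S"
  shows "BigAnd A f \<in> y \<longleftrightarrow> (\<forall>i\<in>A. f i \<in> y)"
proof -
  have "foldr (\<lambda>i \<phi>. f i \<^bold>\<and> \<phi>) xs Top \<in> y \<longleftrightarrow> (\<forall>i\<in>set xs. f i \<in> y)"
    if "\<forall>i\<in>set xs. f i \<in> Form T S" for xs
    using that
    by (induction xs)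
      (auto simp: maximal_And[OF assms(1,2)] maximal_Bot[OF assms(1,2)] maximal_Neg[OF assms(2)]
        Top_def foldr_And_Form[unfolded Top_def])
  from this[of "enumeration A"] assms(3,4) show ?thesis
    by (simp add: BigAnd_def set_enumeration)
qed

text \<open>A form of completeness: if the negation of \<open>\<phi>\<close> were consistent, a
  maximal set would contain it together with \<open>\<phi>\<close>.\<close>

lemma lindenbaum_derivable:
  assumes "lindenbaum T D" "S \<in> Ing T" "\<phi> \<in> Form T S" "\<forall>y\<in>Max_sets T D S. \<phi> \<in> y"
  shows "D S {} \<phi>"
proof -
  have "\<not> consistent D S {\<^bold>\<not> \<phi>}"
  proof
    assume "consistent D S {\<^bold>\<not> \<phi>}"
    then obtain y where "y \<in> Max_sets T D S" "(\<^bold>\<not> \<phi>) \<in> y"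
      using assms(1-3) unfolding lindenbaum_def
      by (metis Form_Neg empty_subsetI insert_subset)
    with assms show False
      by auto
  qed
  then have "D S {} (\<^bold>\<not> \<phi> \<^bold>\<longrightarrow> Bot)"
    using assms(2) by (auto simp: consistent_def intro!: deduction)
  \<comment> \<open>Deduction yields only the double negation of \<open>\<phi>\<close>; this
    tautology removes it.\<close>
  moreover have "D S {} ((\<^bold>\<not> \<phi> \<^bold>\<longrightarrow> Bot) \<^bold>\<longrightarrow> \<phi>)"
    using assms(2,3)
    by (intro assumption) (auto intro!: Ax.taut simp: tautology_def Neg_def)
  ultimately show ?thesis
    using derive_mp assms(2) by blast
qed

section \<open>The Boolean algebra of extensions\<close>

lemma ext_Bot: "S \<in> Ing T \<Longrightarrow> ext T D S Bot = {}"
  using maximal_Bot by (auto simp: ext_def)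

lemma ext_Neg: "\<phi> \<in> Form T S \<Longrightarrow> ext T D S (\<^bold>\<not> \<phi>) = Max_sets T D S - ext T D S \<phi>"
  by (auto simp: ext_def)

lemma ext_Or:
  "S \<in> Ing T \<Longrightarrow> \<phi> \<in> Form T S \<Longrightarrow> \<psi> \<in> Form T S \<Longrightarrow>
    ext T D S (\<phi> \<^bold>\<or> \<psi>) = ext T D S \<phi> \<union> ext T D S \<psi>"
  by (auto simp: ext_def maximal_Or)

lemma ext_BigOr:
  "S \<in> Ing T \<Longrightarrow> finite A \<Longrightarrow> \<forall>i\<in>A. f i \<in> Form T S \<Longrightarrow>
    ext T D S (BigOr A f) = (\<Union>i\<in>A. ext T D S (f i))"
  by (auto simp: ext_def maximal_BigOr)

text \<open>The index set must be nonempty: an empty intersection is the whole type, whereas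
  \<open>Top\<close> has extension \<open>Max_sets T D S\<close>.\<close>

lemma ext_BigAnd:
  "S \<in> Ing T \<Longrightarrow> finite A \<Longrightarrow> A \<noteq> {} \<Longrightarrow> \<forall>i\<in>A. f i \<in> Form T S \<Longrightarrow>
    ext T D S (BigAnd A f) = (\<Inter>i\<in>A. ext T D S (f i))"
  by (auto simp: ext_def maximal_BigAnd)

lemma algebra_ext_algebra:
  assumes "S \<in> Ing T"
  shows "algebra (Max_sets T D S) (ext_algebra T D S)"
  unfolding algebra_iff_Un ext_algebra_def
proof (intro conjI ballI)
  show "ext T D S ` MForm T S \<subseteq> Pow (Max_sets T D S)"
    by (auto simp: ext_def)
  show "{} \<in> ext T D S ` MForm T S"
    by (rule image_eqI[where x = Bot]) (simp_all add: ext_Bot assms)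
next
  fix U
  assume "U \<in> ext T D S ` MForm T S"
  then obtain \<phi> where "\<phi> \<in> MForm T S" "U = ext T D S \<phi>"
    by blast
  then show "Max_sets T D S - U \<in> ext T D S ` MForm T S"
    by (intro image_eqI[of _ _ "\<^bold>\<not> \<phi>"]) (auto simp: ext_Neg MForm_Form)
next
  fix U V
  assume "U \<in> ext T D S ` MForm T S" "V \<in> ext T D S ` MForm T S"
  then obtain \<phi> \<psi> where "\<phi> \<in> MForm T S" "U = ext T D S \<phi>" "\<psi> \<in> MForm T S" "V = ext T D S \<psi>"
    by blast
  then show "U \<union> V \<in> ext T D S ` MForm T S"
    by (intro image_eqI[of _ _ "\<phi> \<^bold>\<or> \<psi>"]) (auto simp: ext_Or MForm_Form assms)
qed

end

section \<open>The canonical plausibility measure\<close>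

locale plausibility_point = deduction_system T D
  for T :: "'m ufunctor"
    and D :: "'m ufunctor \<Rightarrow> 'm formula set \<Rightarrow> 'm formula \<Rightarrow> bool" +
  fixes S :: "'m ufunctor" and x :: "'m formula set"
  assumes lind: "lindenbaum T D"
    and Pl_Ing: "FPl S \<in> Ing T"
    and x_max: "x \<in> Max_sets T D (FPl S)"
begin

lemma S_Ing: "S \<in> Ing T"
  using Pl_Ing FDelta_Ing by blast

lemmas x_axiom_mp = maximal_axiom_mp[OF Pl_Ing x_max]
lemmas x_theorem = maximal_theorem[OF Pl_Ing x_max]
lemmas x_Neg = maximal_Neg[OF x_max]

text \<open>The premises of the rule may be infinite in number, but they all lie in
  \<open>x\<close>, so one derivation weakened to \<open>x\<close> suffices.\<close>

lemma x_archimedean: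
  assumes "Oge \<in> {Pl_ge, Bel_ge}" "\<phi> \<in> MForm T S" "p \<in> {0..1}"
    and "\<And>q. q \<in> {0..1} \<Longrightarrow> q < p \<Longrightarrow> Oge q \<phi> \<in> x"
  shows "Oge p \<phi> \<in> x"
proof -
  have "D (FPl S) {Oge q \<phi> |q. q \<in> {0..1} \<and> q < p} (Oge p \<phi>)"
    using archimedean_Pl Pl_Ing assms by blast
  moreover have "{Oge q \<phi> |q. q \<in> {0..1} \<and> q < p} \<subseteq> x"
    using assms(4) by blast
  moreover have "x \<subseteq> Form T (FPl S)"
    using x_max by (rule maximal_subset)
  ultimately have "D (FPl S) x (Oge p \<phi>)"
    by (rule weakening[OF Pl_Ing])
  then show ?thesis
    by (rule maximal_closed[OF Pl_Ing x_max])
qed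

section \<open>Modal thresholds in \<open>x\<close> as inequalities for
  \<open>pl_sup\<close>\<close>

lemma Pl_ge_Form: "\<phi> \<in> MForm T S \<Longrightarrow> p \<in> {0..1} \<Longrightarrow> Pl_ge p \<phi> \<in> Form T (FPl S)"
  by (simp add: Pl_ge_def)

text \<open>At threshold 0 the Archimedean rule has no premises. This makes the set in
  \<open>pl_sup\<close> nonempty, which its real supremum requires.\<close>

lemma Pl_ge_zero: "\<phi> \<in> MForm T S \<Longrightarrow> Pl_ge 0 \<phi> \<in> x"
  by (rule x_archimedean[where Oge = Pl_ge]) auto

lemma Pl_le_if_not_ge:
  "\<phi> \<in> MForm T S \<Longrightarrow> p \<in> {0..1} \<Longrightarrow> Pl_ge p \<phi> \<notin> x \<Longrightarrow> Pl_le p \<phi> \<in> x"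
  using x_axiom_mp[OF Ax.Pl_lt_le] by (simp add: Pl_lt_def x_Neg Pl_ge_Form)

lemma not_Pl_ge_if_le:
  "\<phi> \<in> MForm T S \<Longrightarrow> p \<in> {0..1} \<Longrightarrow> q \<in> {0..1} \<Longrightarrow> p < q \<Longrightarrow> Pl_le p \<phi> \<in> x \<Longrightarrow> Pl_ge q \<phi> \<notin> x"
  using x_axiom_mp[OF Ax.Pl_le_lt, of \<phi> p q] by (simp add: Pl_lt_def x_Neg Pl_ge_Form)

lemma pl_sup_bounds:
  assumes "\<phi> \<in> MForm T S"
  shows "pl_sup x \<phi> \<in> {0..1}"
proof -
  have "0 \<le> pl_sup x \<phi>"
    unfolding pl_sup_def using Pl_ge_zero[OF assms]
    by (intro cSup_upper) (auto intro: bdd_aboveI[of _ 1])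
  moreover have "pl_sup x \<phi> \<le> 1"
    unfolding pl_sup_def using Pl_ge_zero[OF assms]
    by (intro cSup_least) (auto intro: exI[of _ 0])
  ultimately show ?thesis
    by simp
qed

text \<open>The right-to-left direction contains the attainment of the supremum: every
  \<open>q < p\<close> lies strictly below some threshold \<open>r\<close> that holds in
  \<open>x\<close>, hence holds itself, and the Archimedean rule passes to \<open>p\<close>.\<close>

lemma Pl_ge_iff:
  assumes "\<phi> \<in> MForm T S" "p \<in> {0..1}"
  shows "Pl_ge p \<phi> \<in> x \<longleftrightarrow> p \<le> pl_sup x \<phi>"
proof
  assume "Pl_ge p \<phi> \<in> x"
  then show "p \<le> pl_sup x \<phi>"
    unfolding pl_sup_def using assms
    by (intro cSup_upper) (auto intro: bdd_aboveI[of _ 1])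
next
  assume p: "p \<le> pl_sup x \<phi>"
  show "Pl_ge p \<phi> \<in> x"
  proof (rule x_archimedean[where Oge = Pl_ge])
    fix q :: real
    assume q: "q \<in> {0..1}" "q < p"
    have "{q \<in> {0..1}. Pl_ge q \<phi> \<in> x} \<noteq> {}"
      using Pl_ge_zero[OF assms(1)] by (auto intro: exI[of _ 0])
    moreover have "q < Sup {q \<in> {0..1}. Pl_ge q \<phi> \<in> x}"
      using p q by (simp add: pl_sup_def)
    ultimately have "\<exists>r\<in>{q \<in> {0..1}. Pl_ge q \<phi> \<in> x}. q < r"
      by (rule less_cSupD)
    then obtain r where r: "r \<in> {0..1}" "Pl_ge r \<phi> \<in> x" "q < r"
      by blast
    \<comment> \<open>Thresholds are downward closed: otherwise \<open>Pl_le q \<phi>\<close> would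
      be in \<open>x\<close> and exclude the larger \<open>r\<close>.\<close>
    then show "Pl_ge q \<phi> \<in> x"
      using Pl_le_if_not_ge[OF assms(1) q(1)] not_Pl_ge_if_le[OF assms(1) q(1) r(1,3)] by blast
  qed (use assms in auto)
qed

text \<open>By definition \<open>Pl_le p \<phi>\<close> is a \<open>Bel_ge (1 - p)\<close> formula
  about the negation of \<open>\<phi>\<close>, so the Archimedean rule for \<open>Bel_ge\<close>
  supplies the boundary case \<open>p = pl_sup x \<phi>\<close>.\<close>

lemma Pl_le_iff:
  assumes "\<phi> \<in> MForm T S" "p \<in> {0..1}"
  shows "Pl_le p \<phi> \<in> x \<longleftrightarrow> pl_sup x \<phi> \<le> p"
proof
  assume le: "Pl_le p \<phi> \<in> x"
  show "pl_sup x \<phi> \<le> p"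
  proof (rule ccontr)
    assume "\<not> pl_sup x \<phi> \<le> p"
    then have "Pl_ge (pl_sup x \<phi>) \<phi> \<notin> x"
      using not_Pl_ge_if_le[OF assms pl_sup_bounds[OF assms(1)]] le by simp
    then show False
      using Pl_ge_iff[OF assms(1) pl_sup_bounds[OF assms(1)]] by simp
  qed
next
  assume p: "pl_sup x \<phi> \<le> p"
  have "Bel_ge (1 - p) (\<^bold>\<not> \<phi>) \<in> x"
  proof (rule x_archimedean[where Oge = Bel_ge])
    fix q :: real
    assume q: "q \<in> {0..1}" "q < 1 - p"
    \<comment> \<open>Here \<open>1 - q > p \<ge> pl_sup x \<phi>\<close>. The strict gap is what
      the Archimedean rule provides: it turns a failing \<open>Pl_ge\<close> into the
      \<open>Pl_le\<close> that unfolds to the goal.\<close>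
    then have "Pl_ge (1 - q) \<phi> \<notin> x"
      using p assms by (subst Pl_ge_iff) auto
    then have "Pl_le (1 - q) \<phi> \<in> x"
      using Pl_le_if_not_ge[OF assms(1)] q by auto
    then show "Bel_ge q (\<^bold>\<not> \<phi>) \<in> x"
      by (simp add: Pl_le_def Bel_ge_def)
  qed (use assms in auto)
  then show "Pl_le p \<phi> \<in> x"
    by (simp add: Pl_le_def Bel_ge_def)
qed

lemma pl_sup_mono:
  assumes "\<phi> \<in> MForm T S" "\<psi> \<in> MForm T S" "ext T D S \<phi> \<subseteq> ext T D S \<psi>"
  shows "pl_sup x \<phi> \<le> pl_sup x \<psi>"
proof -
  have "D S {} (\<phi> \<^bold>\<longrightarrow> \<psi>)"
    using assms
    by (intro lindenbaum_derivable lind S_Ing)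
      (auto simp: MForm_Form maximal_Imp[OF S_Ing] ext_def)
  then have "D (FPl S) {} (Bel_ge 1 (\<phi> \<^bold>\<longrightarrow> \<psi>))"
    using assms Pl_Ing by (intro necessitation_Bel) auto
  then have "Bel_ge 1 (\<phi> \<^bold>\<longrightarrow> \<psi>) \<in> x"
    by (rule x_theorem)
  \<comment> \<open>The monotonicity axiom is used at the attained value
    \<open>pl_sup x \<phi>\<close>, so a single instance gives the inequality.\<close>
  then have "(Pl_ge (pl_sup x \<phi>) \<phi> \<^bold>\<longrightarrow> Pl_ge (pl_sup x \<phi>) \<psi>) \<in> x"
    by (rule x_axiom_mp[OF Ax.Pl_mono[OF assms(1,2) pl_sup_bounds[OF assms(1)]]])
  moreover have "Pl_ge (pl_sup x \<phi>) \<phi> \<in> x"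
    using Pl_ge_iff pl_sup_bounds assms(1) by blast
  ultimately have "Pl_ge (pl_sup x \<phi>) \<psi> \<in> x"
    using maximal_mp Pl_Ing x_max by blast
  then show ?thesis
    using Pl_ge_iff pl_sup_bounds assms(1,2) by blast
qed

lemma pl_sup_cong:
  "\<phi> \<in> MForm T S \<Longrightarrow> \<psi> \<in> MForm T S \<Longrightarrow> ext T D S \<phi> = ext T D S \<psi> \<Longrightarrow> pl_sup x \<phi> = pl_sup x \<psi>"
  by (simp add: order_antisym pl_sup_mono)

text \<open>The definite description is unique by \<open>pl_sup_cong\<close>, since all
  representatives of the extension give the same value.\<close>

lemma canonical_pl_ext:
  assumes "\<phi> \<in> MForm T S"
  shows "canonical_pl T D S x (ext T D S \<phi>) = pl_sup x \<phi>"
  unfolding canonical_pl_def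
  by (rule the_equality) (use assms pl_sup_cong in blast)+

text \<open>\<open>Pl_le 0 Bot\<close> unfolds to \<open>Bel_ge 1\<close> of the negation of
  \<open>Bot\<close>, which necessitation provides.\<close>

lemma pl_sup_Bot: "pl_sup x Bot = 0"
proof -
  have "D S {} (\<^bold>\<not> Bot)"
    using S_Ing by (intro assumption) (auto intro!: Ax.taut simp: tautology_def Neg_def)
  then have "D (FPl S) {} (Bel_ge 1 (\<^bold>\<not> Bot))"
    using Pl_Ing by (intro necessitation_Bel) auto
  then have "Bel_ge 1 (\<^bold>\<not> Bot) \<in> x"
    by (rule x_theorem)
  then have "Pl_le 0 Bot \<in> x"
    by (simp add: Pl_le_def Bel_ge_def)
  then show ?thesis
    using Pl_le_iff[of Bot 0] pl_sup_bounds[of Bot] by simp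
qed

text \<open>The axiom \<open>Pl_Bel\<close> turns an upper bound for a formula into a lower bound
  for its negation. With the exact value \<open>?p\<close> this reads
  \<open>1 - ?p \<le> pl_sup x Bot = 0\<close>.\<close>

lemma pl_sup_Neg_Bot: "pl_sup x (\<^bold>\<not> Bot) = 1"
proof -
  let ?p = "pl_sup x (\<^bold>\<not> Bot)"
  have p: "?p \<in> {0..1}"
    by (rule pl_sup_bounds) simp
  then have "Pl_le ?p (\<^bold>\<not> Bot) \<in> x"
    by (simp add: Pl_le_iff)
  then have "Bel_le ?p (\<^bold>\<not> Bot) \<in> x"
    by (rule x_axiom_mp[OF Ax.Pl_Bel, rotated 2]) (use p in auto)
  then have "Pl_ge (1 - ?p) (\<^bold>\<not> \<^bold>\<not> Bot) \<in> x"
    by (simp add: Bel_le_def Pl_ge_def)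
  then have "1 - ?p \<le> pl_sup x (\<^bold>\<not> \<^bold>\<not> Bot)"
    using p by (subst (asm) Pl_ge_iff) auto
  \<comment> \<open>The double negation of \<open>Bot\<close> is a different formula from
    \<open>Bot\<close>, but both have empty extension.\<close>
  also have "\<dots> = pl_sup x Bot"
    by (rule pl_sup_cong) (auto simp: ext_def)
  finally show ?thesis
    using p by (simp add: pl_sup_Bot)
qed

lemma pl_sup_incl_excl:
  assumes "n \<ge> 1" "\<forall>i\<in>{1..n}. \<phi> i \<in> MForm T S"
  shows "pl_sup x (BigAnd {1..n} \<phi>)
    \<le> (\<Sum>I\<in>nonempty_subsets n. (-1) ^ (card I + 1) * pl_sup x (BigOr I \<phi>))"
    (is "_ \<le> ?q")
proof -
  have Or: "BigOr I \<phi> \<in> MForm T S" if "I \<in> nonempty_subsets n" for I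
    using that assms(2) by (intro BigOr_MForm) (auto intro: finite_subset)
  then have p: "\<forall>I\<in>nonempty_subsets n. pl_sup x (BigOr I \<phi>) \<in> {0..1}"
    using pl_sup_bounds by blast
  let ?f = "\<lambda>I. Pl_alt (card I) (pl_sup x (BigOr I \<phi>)) (BigOr I \<phi>)"
  \<comment> \<open>\<open>Pl_alt\<close> asks for an upper bound when \<open>card I\<close> is odd
    and for a lower bound when it is even; the exact value meets both.\<close>
  have "?f I \<in> x" if "I \<in> nonempty_subsets n" for I
    using Or[OF that] p that by (simp add: Pl_alt_def Pl_le_iff Pl_ge_iff)
  then have conj: "BigAnd (nonempty_subsets n) ?f \<in> x"
    using maximal_subset[OF x_max]
    by (subst maximal_BigAnd[OF Pl_Ing x_max]) auto
  \<comment> \<open>Recorded because \<open>x_Neg\<close>, which refutes \<open>?q < 0\<close>,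
    applies only to formulas of the right sort.\<close>
  then have "BigAnd (nonempty_subsets n) ?f \<in> Form T (FPl S)"
    using maximal_subset[OF x_max] by blast
  with conj have "?q \<ge> 0"
    using maximal_axiom[OF Pl_Ing x_max Ax.Pl_incl_excl_neg[OF assms p refl]] x_Neg
    by fastforce
  then have "Pl_le (min ?q 1) (BigAnd {1..n} \<phi>) \<in> x"
    using x_axiom_mp[OF Ax.Pl_incl_excl[OF assms p refl]] conj by blast
  moreover have "BigAnd {1..n} \<phi> \<in> MForm T S"
    using assms(2) by (intro BigAnd_MForm) auto
  \<comment> \<open>With \<open>?q \<ge> 0\<close> the truncated bound lies in the unit interval, as
    \<open>Pl_le_iff\<close> demands.\<close>
  ultimately have "pl_sup x (BigAnd {1..n} \<phi>) \<le> min ?q 1"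
    using \<open>?q \<ge> 0\<close> Pl_le_iff[of "BigAnd {1..n} \<phi>" "min ?q 1"] by auto
  then show ?thesis
    by simp
qed

text \<open>Representing formulas turn intersections into \<open>BigAnd\<close> and unions into
  \<open>BigOr\<close>, which reduces the inequality for sets to
  \<open>pl_sup_incl_excl\<close>.\<close>

lemma plausibility_measure_canonical_pl:
  "plausibility_measure (Max_sets T D S) (ext_algebra T D S) (canonical_pl T D S x)"
  unfolding plausibility_measure_def
proof (intro conjI allI impI)
  let ?\<gamma> = "canonical_pl T D S x"
  show "algebra (Max_sets T D S) (ext_algebra T D S)"
    by (rule algebra_ext_algebra[OF S_Ing])
  show "\<forall>U\<in>ext_algebra T D S. 0 \<le> ?\<gamma> U \<and> ?\<gamma> U \<le> 1"
    using pl_sup_bounds by (auto simp: ext_algebra_def canonical_pl_ext)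
  show "?\<gamma> {} = 0"
    using canonical_pl_ext[of Bot] by (simp add: ext_Bot S_Ing pl_sup_Bot)
  show "?\<gamma> (Max_sets T D S) = 1"
    using canonical_pl_ext[of "\<^bold>\<not> Bot"] by (simp add: ext_Neg ext_Bot S_Ing pl_sup_Neg_Bot)
  fix n :: nat and U
  assume n: "1 \<le> n" and "\<forall>i\<in>{1..n}. U i \<in> ext_algebra T D S"
  then have "\<forall>i\<in>{1..n}. \<exists>\<psi>. \<psi> \<in> MForm T S \<and> U i = ext T D S \<psi>"
    by (auto simp: ext_algebra_def)
  \<comment> \<open>A choice of one representing formula for each index in
    \<open>{1..n}\<close>.\<close>
  then obtain \<phi> where \<phi>: "\<forall>i\<in>{1..n}. \<phi> i \<in> MForm T S \<and> U i = ext T D S (\<phi> i)"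
    by metis
  have "(\<Inter>i\<in>{1..n}. U i) = ext T D S (BigAnd {1..n} \<phi>)"
    using n \<phi> by (subst ext_BigAnd) (auto simp: S_Ing MForm_Form)
  moreover have "BigAnd {1..n} \<phi> \<in> MForm T S"
    using \<phi> by (intro BigAnd_MForm) auto
  ultimately have Inter: "?\<gamma> (\<Inter>i\<in>{1..n}. U i) = pl_sup x (BigAnd {1..n} \<phi>)"
    by (simp add: canonical_pl_ext)
  have Union: "?\<gamma> (\<Union>i\<in>I. U i) = pl_sup x (BigOr I \<phi>)" if "I \<in> nonempty_subsets n" for I
  proof -
    have I: "finite I" "\<forall>i\<in>I. \<phi> i \<in> MForm T S \<and> U i = ext T D S (\<phi> i)"
      using that \<phi> by (auto intro: finite_subset)
    then have "(\<Union>i\<in>I. U i) = ext T D S (BigOr I \<phi>)"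
      by (subst ext_BigOr) (auto simp: S_Ing MForm_Form)
    with I show ?thesis
      by (simp add: canonical_pl_ext BigOr_MForm)
  qed
  have "(\<Sum>I\<in>nonempty_subsets n. (-1) ^ (card I + 1) * ?\<gamma> (\<Union>i\<in>I. U i))
      = (\<Sum>I\<in>nonempty_subsets n. (-1) ^ (card I + 1) * pl_sup x (BigOr I \<phi>))"
    by (intro sum.cong refl) (simp only: Union)
  with Inter pl_sup_incl_excl[OF n, of \<phi>] \<phi>
  show "?\<gamma> (\<Inter>i\<in>{1..n}. U i)
      \<le> (\<Sum>I\<in>nonempty_subsets n. (-1) ^ (card I + 1) * ?\<gamma> (\<Union>i\<in>I. U i))"
    by simp
qed

end

theorem theorem5p15:
  fixes T S :: "'m ufunctor"
    and D :: "'m ufunctor \<Rightarrow> 'm formula set \<Rightarrow> 'm formula \<Rightarrow> bool"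
    and x :: "'m formula set"
  assumes "uncertainty_polynomial_functor T"
    and "deduction_system T D"
    and "lindenbaum T D"
    and "FPl S \<in> Ing T"
    and "x \<in> Max_sets T D (FPl S)"
  shows "(\<forall>\<phi>\<in>MForm T S. \<forall>\<psi>\<in>MForm T S. ext T D S \<phi> = ext T D S \<psi> \<longrightarrow> pl_sup x \<phi> = pl_sup x \<psi>)
    \<and> (\<forall>\<phi>\<in>MForm T S. canonical_pl T D S x (ext T D S \<phi>) = pl_sup x \<phi>)
    \<and> plausibility_measure (Max_sets T D S) (ext_algebra T D S) (canonical_pl T D S x)"
proof -
  interpret plausibility_point T D S x
    using assms(2-5) by (simp add: plausibility_point_def plausibility_point_axioms_def)
  show ?thesis
    using pl_sup_cong canonical_pl_ext plausibility_measure_canonical_pl by blast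
qed

end
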